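(* (1) For every integer $d \ge 2$ and every integer $k \ge 1$ there exists a matrix $A: X \times Y \rightarrow \{0,1,\ldots,k\}$ such that $\mathrm{Pdim}(A) = d$, $\mathrm{Vdim}^*(A) = 2^d$ and $\mathrm{Pdim}^*(A) = k \cdot 2^d$. (2) For every integer $k \ge 1$ there exists a matrix $A: X \times Y \rightarrow \{0,1,\ldots,k\}$ such that $\mathrm{Vdim}(A) = \mathrm{Pdim}(A) = 1$ and $\mathrm{Pdim}^*(A) = k+2$.
   Context: A matrix is a function $A: X \times Y \rightarrow Z$ with $Z \subseteq \mathbb{R}$ (rows indexed by $X$, columns by $Y$). A set $J \subseteq Y$ is P-shattered by $A$ if there is $\vec t: J \rightarrow \mathbb{R}$ such that for every $b: J \rightarrow \{0,1\}$ there is $x \in X$ with, for all $y \in J$, $A(x,y) \ge \vec t(y)$ iff $b(y)=1$. $J$ is V-shattered by $A$ if the same holds with a single number $t \in \mathbb{R}$ used for all $y\in J$ in place of $\vec t(y)$. $\mathrm{Pdim}(A)$ (resp. $\mathrm{Vdim}(A)$) is the largest size of a P-shattered (resp. V-shattered) set $J\subseteq Y$, or $\infty$ if such sets of unbounded size exist. The transpose $A^\top: Y \times X \rightarrow Z$ is $A^\top(y,x) = A(x,y)$, and the dual dimensions are $\mathrm{Pdim}^*(A) := \mathrm{Pdim}(A^\top)$, $\mathrm{Vdim}^*(A) := \mathrm{Vdim}(A^\top)$. *)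

theory Defs
  imports Complex_Main "HOL-Library.Extended_Nat" "HOL-Library.FuncSet"
begin

text \<open>A matrix with row set \<open>X\<close>, column set \<open>Y\<close> and entries in \<open>Z\<close> is a function
  \<open>A \<in> X \<times> Y \<rightarrow> Z\<close>; only its values on \<open>X \<times> Y\<close> matter below. Likewise the thresholds \<open>t\<close>
  and the bit patterns \<open>b\<close> are total functions of which only the values on \<open>J\<close> are used.\<close>

definition P_shattered :: "'a set \<Rightarrow> 'b set \<Rightarrow> ('a \<times> 'b \<Rightarrow> real) \<Rightarrow> 'b set \<Rightarrow> bool" where
  "P_shattered X Y A J \<longleftrightarrow> J \<subseteq> Y \<and>
     (\<exists>t :: 'b \<Rightarrow> real. \<forall>b :: 'b \<Rightarrow> bool. \<exists>x\<in>X. \<forall>y\<in>J. A (x, y) \<ge> t y \<longleftrightarrow> b y)"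

definition V_shattered :: "'a set \<Rightarrow> 'b set \<Rightarrow> ('a \<times> 'b \<Rightarrow> real) \<Rightarrow> 'b set \<Rightarrow> bool" where
  "V_shattered X Y A J \<longleftrightarrow> J \<subseteq> Y \<and>
     (\<exists>t :: real. \<forall>b :: 'b \<Rightarrow> bool. \<exists>x\<in>X. \<forall>y\<in>J. A (x, y) \<ge> t \<longleftrightarrow> b y)"

text \<open>The suprema are taken in \<^typ>\<open>enat\<close>: they are maxima when the sizes are bounded and
  \<open>\<infinity>\<close> otherwise. Restricting to finite \<open>J\<close> loses nothing, since subsets of shattered sets are
  shattered; it is needed because \<^const>\<open>card\<close> is \<open>0\<close> on infinite sets. If \<open>X = {}\<close>, no set is
  shattered and the dimension is \<open>0\<close> by convention.\<close>

definition Pdim :: "'a set \<Rightarrow> 'b set \<Rightarrow> ('a \<times> 'b \<Rightarrow> real) \<Rightarrow> enat" where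
  "Pdim X Y A = (SUP J\<in>{J. finite J \<and> P_shattered X Y A J}. enat (card J))"

definition Vdim :: "'a set \<Rightarrow> 'b set \<Rightarrow> ('a \<times> 'b \<Rightarrow> real) \<Rightarrow> enat" where
  "Vdim X Y A = (SUP J\<in>{J. finite J \<and> V_shattered X Y A J}. enat (card J))"

definition matrix_transpose :: "('a \<times> 'b \<Rightarrow> real) \<Rightarrow> ('b \<times> 'a \<Rightarrow> real)" where
  "matrix_transpose A = (\<lambda>(y, x). A (x, y))"

definition dual_Pdim :: "'a set \<Rightarrow> 'b set \<Rightarrow> ('a \<times> 'b \<Rightarrow> real) \<Rightarrow> enat" where
  "dual_Pdim X Y A = Pdim Y X (matrix_transpose A)"

definition dual_Vdim :: "'a set \<Rightarrow> 'b set \<Rightarrow> ('a \<times> 'b \<Rightarrow> real) \<Rightarrow> enat" where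
  "dual_Vdim X Y A = Vdim Y X (matrix_transpose A)"

end

theory Submission
  imports Defs "HOL-Library.Nat_Bijection"
begin

text \<open>Give every row \<open>r\<close> a level \<open>l r\<close> and let the columns realise all ways of choosing, in each
  row, one of the two entries \<open>l r\<close> and \<open>l r + 1\<close>. Then the set of all rows is dually P-shattered,
  whereas dually V-shattered rows share a level. Conversely, two P-shattered columns must have
  thresholds of the same height \<open>c\<close>, so that rows of level other than \<open>c\<close> produce only the two
  constant patterns. Part (1) uses \<open>k\<close> levels with \<open>2\<^sup>d\<close> rows each, part (2) the levels
  \<open>0, 0, 1, \<dots>, k - 2, k - 1, k - 1\<close>.\<close>

section \<open>Dimensions attained by a largest finite shattered set\<close>

lemma Pdim_eqI:
  assumes "finite J" "P_shattered X Y A J" "card J = n"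
    and "\<And>J. finite J \<Longrightarrow> P_shattered X Y A J \<Longrightarrow> card J \<le> n"
  shows "Pdim X Y A = enat n"
  unfolding Pdim_def
proof (rule antisym)
  show "(SUP J\<in>{J. finite J \<and> P_shattered X Y A J}. enat (card J)) \<le> enat n"
    using assms(4) by (intro SUP_least) auto
  show "enat n \<le> (SUP J\<in>{J. finite J \<and> P_shattered X Y A J}. enat (card J))"
    using assms(1-3) by (intro SUP_upper2[of J]) auto
qed

lemma Vdim_eqI:
  assumes "finite J" "V_shattered X Y A J" "card J = n"
    and "\<And>J. finite J \<Longrightarrow> V_shattered X Y A J \<Longrightarrow> card J \<le> n"
  shows "Vdim X Y A = enat n"
  unfolding Vdim_def
proof (rule antisym)
  show "(SUP J\<in>{J. finite J \<and> V_shattered X Y A J}. enat (card J)) \<le> enat n"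
    using assms(4) by (intro SUP_least) auto
  show "enat n \<le> (SUP J\<in>{J. finite J \<and> V_shattered X Y A J}. enat (card J))"
    using assms(1-3) by (intro SUP_upper2[of J]) auto
qed

lemma V_shattered_imp_P_shattered: "V_shattered X Y A J \<Longrightarrow> P_shattered X Y A J"
  unfolding V_shattered_def P_shattered_def by (elim conjE exE) (intro conjI exI)

section \<open>Matrices with two adjacent entries in each row\<close>

text \<open>The binary digits of a column mark the rows that take the larger entry. With all
  naturals as columns, every finite set of rows is thus marked by some column.\<close>

definition level_matrix :: "(nat \<Rightarrow> nat) \<Rightarrow> nat \<times> nat \<Rightarrow> real" where
  "level_matrix l = (\<lambda>(r, y). real (l r) + of_bool (r \<in> set_decode y))"

lemma level_matrix_in:
  assumes "\<And>r. r \<in> X \<Longrightarrow> l r < k"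
  shows "level_matrix l \<in> X \<times> Y \<rightarrow> real ` {0..k}"
proof (rule funcsetI)
  fix p assume "p \<in> X \<times> Y"
  then obtain r y where p: "p = (r, y)" "l r < k" using assms by auto
  have "level_matrix l p = real (l r + of_bool (r \<in> set_decode y))"
    by (simp add: level_matrix_def p(1))
  moreover have "l r + of_bool (r \<in> set_decode y) \<in> {0..k}" using p(2) by simp
  ultimately show "level_matrix l p \<in> real ` {0..k}" by (rule image_eqI)
qed

text \<open>Together with \<open>level_matrix_ge_level\<close> this replaces a real threshold by its
  ceiling: if \<open>t\<close> separates two entries of row \<open>r\<close>, then
  \<open>\<lceil>t\<rceil> = l r + 1\<close>.\<close>

lemma level_matrix_less_level:
  "level_matrix l (r, y) < t \<Longrightarrow> int (l r) < \<lceil>t\<rceil>"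
  by (auto simp: level_matrix_def less_ceiling_iff of_bool_def split: if_splits)

lemma level_matrix_ge_level:
  "t \<le> level_matrix l (r, y) \<Longrightarrow> \<lceil>t\<rceil> \<le> int (l r) + 1"
  by (auto simp: level_matrix_def ceiling_le_iff of_bool_def split: if_splits)

section \<open>Shattered sets of rows\<close>

lemma dual_P_shattered_level_matrix:
  assumes "finite X"
  shows "P_shattered UNIV X (matrix_transpose (level_matrix l)) X"
  unfolding P_shattered_def
\<comment> \<open>The threshold of a row is the larger of its two entries, so it is met exactly in
  the columns that mark the row.\<close>
proof (intro conjI exI[of _ "\<lambda>r. real (l r) + 1"] allI)
  fix b :: "nat \<Rightarrow> bool"
  have "finite {r \<in> X. b r}" using assms by simp
  then have "\<forall>r\<in>X. real (l r) + 1 \<le> matrix_transpose (level_matrix l) (set_encode {r \<in> X. b r}, r) \<longleftrightarrow> b r"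
    by (auto simp: matrix_transpose_def level_matrix_def)
  then show "\<exists>y\<in>UNIV. \<forall>r\<in>X. real (l r) + 1 \<le> matrix_transpose (level_matrix l) (y, r) \<longleftrightarrow> b r"
    by blast
qed simp

lemma dual_Pdim_level_matrix:
  assumes "finite X"
  shows "dual_Pdim X UNIV (level_matrix l) = enat (card X)"
  unfolding dual_Pdim_def
  using assms dual_P_shattered_level_matrix[OF assms]
  by (intro Pdim_eqI[of X]) (auto simp: P_shattered_def intro: card_mono)

text \<open>The two constant patterns put entries of every row of \<open>J\<close> on both sides of
  the common threshold, which forces the level \<open>\<lceil>t\<rceil> - 1\<close> on all of
  them.\<close>

lemma dual_V_shattered_level_matrixD:
  assumes "V_shattered UNIV X (matrix_transpose (level_matrix l)) J"
  obtains c where "J \<subseteq> {r \<in> X. l r = c}"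
proof -
  obtain t where J: "J \<subseteq> X"
    and t: "\<And>b. \<exists>y. \<forall>r\<in>J. level_matrix l (r, y) \<ge> t \<longleftrightarrow> b r"
    using assms by (auto simp: V_shattered_def matrix_transpose_def)
  obtain y0 y1 where y: "\<And>r. r \<in> J \<Longrightarrow> level_matrix l (r, y0) < t"
      "\<And>r. r \<in> J \<Longrightarrow> level_matrix l (r, y1) \<ge> t"
    using t[of "\<lambda>_. False"] t[of "\<lambda>_. True"] by (auto simp: not_le)
  have "int (l r) = \<lceil>t\<rceil> - 1" if "r \<in> J" for r
    using level_matrix_less_level[OF y(1)[OF that]] level_matrix_ge_level[OF y(2)[OF that]]
    by linarith
  then have "J \<subseteq> {r \<in> X. l r = nat (\<lceil>t\<rceil> - 1)}" using J by force
  then show ?thesis by (rule that)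
qed

lemma dual_V_shattered_level_matrixI:
  assumes "finite X"
  shows "V_shattered UNIV X (matrix_transpose (level_matrix l)) {r \<in> X. l r = c}"
proof -
  have "\<exists>y. \<forall>r\<in>{r \<in> X. l r = c}. level_matrix l (r, y) \<ge> real c + 1 \<longleftrightarrow> b r" for b
    using assms by (intro exI[of _ "set_encode {r \<in> X. b r}"]) (auto simp: level_matrix_def)
  then show ?thesis
    by (auto simp: V_shattered_def matrix_transpose_def intro!: exI[of _ "real c + 1"])
qed

section \<open>Shattered sets of columns\<close>

text \<open>Count the patterns on \<open>J\<close>: each row of level \<open>c\<close> contributes
  at most one, all lower rows together only the empty one, all higher rows together only the full
  one.\<close>

lemma P_shattered_level_matrix_bound:
  assumes "finite X" "finite J" "card J \<ge> 2" "P_shattered X Y (level_matrix l) J"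
  obtains c where
    "2 ^ card J \<le> card {r \<in> X. l r = c} + of_bool (\<exists>r\<in>X. l r < c) + of_bool (\<exists>r\<in>X. l r > c)"
proof -
  obtain t where t: "\<And>b. \<exists>r\<in>X. \<forall>y\<in>J. level_matrix l (r, y) \<ge> t y \<longleftrightarrow> b y"
    using assms(4) by (auto simp: P_shattered_def)
  \<comment> \<open>A row \<open>r\<close> whose pattern is \<open>{y'}\<close> gives
    \<open>\<lceil>t y'\<rceil> \<le> l r + 1 \<le> \<lceil>t y\<rceil>\<close>. By symmetry all
    ceilings agree.\<close>
  have le: "\<lceil>t y'\<rceil> \<le> \<lceil>t y\<rceil>" if "y \<in> J" "y' \<in> J" for y y'
  proof (cases "y = y'")
    case False
    obtain r where "r \<in> X" and r: "\<forall>z\<in>J. t z \<le> level_matrix l (r, z) \<longleftrightarrow> z = y'"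
      using t[of "\<lambda>z. z = y'"] by (rule bexE)
    have "level_matrix l (r, y) < t y" "level_matrix l (r, y') \<ge> t y'"
      using bspec[OF r \<open>y \<in> J\<close>] bspec[OF r \<open>y' \<in> J\<close>] False by simp_all
    then show ?thesis
      using level_matrix_less_level[of l r y "t y"] level_matrix_ge_level[of "t y'" l r y']
      by linarith
  qed simp
  obtain y0 y1 where y01: "y0 \<in> J" "y1 \<in> J" "y0 \<noteq> y1"
    using assms(2,3) by (metis card_le_Suc0_iff_eq not_less_eq_eq numeral_2_eq_2)
  obtain r0 where "r0 \<in> X" and r: "\<forall>z\<in>J. t z \<le> level_matrix l (r0, z) \<longleftrightarrow> z = y1"
    using t[of "\<lambda>z. z = y1"] by (rule bexE)
  have r0: "level_matrix l (r0, y0) < t y0" "level_matrix l (r0, y1) \<ge> t y1"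
    using bspec[OF r y01(1)] bspec[OF r y01(2)] y01(3) by simp_all
  \<comment> \<open>Row \<open>r0\<close> misses the threshold at \<open>y0\<close> and meets it at
    \<open>y1\<close>, so the common ceiling is \<open>l r0 + 1\<close>.\<close>
  define c where "c = l r0"
  have c: "\<lceil>t y\<rceil> = int c + 1" if "y \<in> J" for y
    using level_matrix_less_level[OF r0(1)] level_matrix_ge_level[OF r0(2)]
      le[OF that y01(1)] le[OF y01(1) that] le[OF y01(2) that] le[OF that y01(2)]
    unfolding c_def by linarith
  define pat where "pat r = {y \<in> J. level_matrix l (r, y) \<ge> t y}" for r
  define lo where "lo = {r \<in> X. l r < c}"
  define hi where "hi = {r \<in> X. l r > c}"
  have "Pow J \<subseteq> pat ` X"
  proof
    fix S assume "S \<in> Pow J"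
    moreover obtain r where "r \<in> X" "\<forall>y\<in>J. level_matrix l (r, y) \<ge> t y \<longleftrightarrow> y \<in> S"
      using t[of "\<lambda>y. y \<in> S"] by (rule bexE)
    ultimately have "S = pat r" by (auto simp: pat_def)
    with \<open>r \<in> X\<close> show "S \<in> pat ` X" by blast
  qed
  also have "pat ` X \<subseteq> pat ` ({r \<in> X. l r = c} \<union> lo \<union> hi)"
    by (rule image_mono) (auto simp: lo_def hi_def)
  finally have "Pow J \<subseteq> pat ` {r \<in> X. l r = c} \<union> pat ` lo \<union> pat ` hi"
    by (simp only: image_Un)
  then have "card (Pow J) \<le> card (pat ` {r \<in> X. l r = c} \<union> pat ` lo \<union> pat ` hi)"
    using assms(1) by (intro card_mono) (auto simp: lo_def hi_def)
  also have "\<dots> \<le> card (pat ` {r \<in> X. l r = c}) + card (pat ` lo) + card (pat ` hi)"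
    by (intro order.trans[OF card_Un_le] add_mono card_Un_le order.refl)
  also have "\<dots> \<le> card {r \<in> X. l r = c} + of_bool (lo \<noteq> {}) + of_bool (hi \<noteq> {})"
  proof (intro add_mono)
    show "card (pat ` {r \<in> X. l r = c}) \<le> card {r \<in> X. l r = c}"
      using assms(1) by (intro card_image_le) simp
    \<comment> \<open>Entries of lower rows are at most \<open>c\<close>, and every threshold
      exceeds \<open>c\<close>. Dually, entries of higher rows are at least \<open>c + 1\<close> and
      meet every threshold.\<close>
    have "pat r = {}" if "r \<in> lo" for r
      using that c level_matrix_ge_level by (force simp: pat_def lo_def)
    then have "pat ` lo \<subseteq> {{}}" by auto
    then show "card (pat ` lo) \<le> of_bool (lo \<noteq> {})"
      using card_mono[of "{{}}" "pat ` lo"] by (cases "lo = {}") auto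
    have "pat r = J" if "r \<in> hi" for r
      using that c level_matrix_less_level by (force simp: pat_def hi_def not_le[symmetric])
    then have "pat ` hi \<subseteq> {J}" by auto
    then show "card (pat ` hi) \<le> of_bool (hi \<noteq> {})"
      using card_mono[of "{J}" "pat ` hi"] by (cases "hi = {}") auto
  qed
  finally have "2 ^ card J \<le> card {r \<in> X. l r = c} + of_bool (lo \<noteq> {}) + of_bool (hi \<noteq> {})"
    using assms(2) by (simp add: card_Pow)
  moreover have "lo \<noteq> {} \<longleftrightarrow> (\<exists>r\<in>X. l r < c)" "hi \<noteq> {} \<longleftrightarrow> (\<exists>r\<in>X. l r > c)"
    by (auto simp: lo_def hi_def)
  ultimately show ?thesis using that[of c] by simp
qed

text \<open>Here the rows \<open>r < 2 ^ d\<close> encode the subsets of \<open>{..<d}\<close>; the \<open>j\<close>-th shattered column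
  indicates whether \<open>j\<close> belongs to the encoded subset.\<close>

lemma P_shattered_level_matrix_exists:
  assumes "{..<2 ^ d} \<subseteq> X" "\<And>r. r < 2 ^ d \<Longrightarrow> l r = 0"
  obtains J where "finite J" "card J = d" "P_shattered X UNIV (level_matrix l) J"
proof -
  define col where "col j = set_encode {r. r < 2 ^ d \<and> j \<in> set_decode r}" for j
  have dec: "set_decode (col j) = {r. r < 2 ^ d \<and> j \<in> set_decode r}" for j
    unfolding col_def by (rule set_encode_inverse) simp
  have small: "set_encode S < 2 ^ d" if "S \<subseteq> {..<d}" for S
  proof -
    have "set_encode S \<le> (\<Sum>j<d. 2 ^ j)"
      unfolding set_encode_def using that by (intro sum_mono2) auto
    also have "\<dots> < 2 ^ d" by (induction d) auto
    finally show ?thesis .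
  qed
  \<comment> \<open>The row encoding \<open>{i}\<close> is marked by \<open>col i\<close> and by no
    \<open>col j\<close> with \<open>j \<noteq> i\<close>.\<close>
  have "inj_on col {..<d}"
  proof (rule inj_onI)
    fix i j assume ij: "i \<in> {..<d}" "j \<in> {..<d}" "col i = col j"
    have i: "set_decode (set_encode {i}) = {i}" by (rule set_encode_inverse) simp
    have "set_encode {i} \<in> set_decode (col i)"
      using small[of "{i}"] ij(1) i by (simp add: dec del: set_encode_insert)
    then have "j \<in> set_decode (set_encode {i})" unfolding ij(3) by (simp add: dec)
    then show "i = j" unfolding i by simp
  qed
  then have "card (col ` {..<d}) = d" by (simp add: card_image)
  moreover have "P_shattered X UNIV (level_matrix l) (col ` {..<d})"
    unfolding P_shattered_def
  \<comment> \<open>The rows below \<open>2 ^ d\<close> have level 0, so the threshold 1 separates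
    their entries 0 and 1.\<close>
  proof (intro conjI exI[of _ "\<lambda>_. 1"] allI)
    fix b :: "nat \<Rightarrow> bool"
    define r where "r = set_encode {j. j < d \<and> b (col j)}"
    have "set_decode r = {j. j < d \<and> b (col j)}"
      unfolding r_def by (rule set_encode_inverse) simp
    moreover have "r < 2 ^ d" unfolding r_def by (rule small) auto
    ultimately have "\<forall>y\<in>col ` {..<d}. 1 \<le> level_matrix l (r, y) \<longleftrightarrow> b y" "r \<in> X"
      using assms by (auto simp: level_matrix_def dec)
    then show "\<exists>r\<in>X. \<forall>y\<in>col ` {..<d}. 1 \<le> level_matrix l (r, y) \<longleftrightarrow> b y" by blast
  qed simp
  ultimately show ?thesis using that[of "col ` {..<d}"] by simp
qed

section \<open>The two families of matrices\<close>

text \<open>Division by \<open>2 ^ d\<close> cuts the rows into \<open>k\<close> consecutive blocks,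
  one for each level. The first block shatters \<open>d\<close> columns.\<close>

lemma equal_levels_matrix:
  fixes d k :: nat
  assumes "d \<ge> 2" "k \<ge> 1"
  defines "X \<equiv> {..<k * 2 ^ d}" and "A \<equiv> level_matrix (\<lambda>r. r div 2 ^ d)"
  shows "A \<in> X \<times> UNIV \<rightarrow> real ` {0..k}" "Pdim X UNIV A = enat d"
    "dual_Vdim X UNIV A = enat (2 ^ d)" "dual_Pdim X UNIV A = enat (k * 2 ^ d)"
proof -
  have fin: "finite X" by (simp add: X_def)
  have "{..<2 ^ d} \<subseteq> X"
  proof -
    have "(1::nat) * 2 ^ d \<le> k * 2 ^ d" using assms(2) by (rule mult_le_mono1)
    then show ?thesis by (auto simp: X_def)
  qed
  have level: "{r \<in> X. r div 2 ^ d = c} \<subseteq> {c * 2 ^ d..<c * 2 ^ d + 2 ^ d}" for c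
    using dividend_less_div_times[of "2 ^ d"] by (auto simp: add.commute)
  then have card_level: "card {r \<in> X. r div 2 ^ d = c} \<le> 2 ^ d" for c
    using card_mono[OF _ level] by simp
  show "A \<in> X \<times> UNIV \<rightarrow> real ` {0..k}"
    unfolding A_def by (rule level_matrix_in) (simp add: X_def less_mult_imp_div_less)
  show "dual_Pdim X UNIV A = enat (k * 2 ^ d)"
    unfolding A_def dual_Pdim_level_matrix[OF fin] by (simp add: X_def)
  have "{r \<in> X. r div 2 ^ d = 0} = {..<2 ^ d}"
    using \<open>{..<2 ^ d} \<subseteq> X\<close> by (auto simp: div_eq_0_iff)
  then have "V_shattered UNIV X (matrix_transpose A) {..<2 ^ d}"
    using dual_V_shattered_level_matrixI[OF fin, of "\<lambda>r. r div 2 ^ d" 0] by (simp add: A_def)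
  then show "dual_Vdim X UNIV A = enat (2 ^ d)"
    unfolding dual_Vdim_def
  proof (rule Vdim_eqI[rotated])
    fix J assume "V_shattered UNIV X (matrix_transpose A) J"
    then obtain c where "J \<subseteq> {r \<in> X. r div 2 ^ d = c}"
      unfolding A_def by (rule dual_V_shattered_level_matrixD)
    then show "card J \<le> 2 ^ d"
      using card_mono[of "{r \<in> X. r div 2 ^ d = c}" J] card_level[of c] fin by fastforce
  qed simp_all
  obtain J\<^sub>0 where J\<^sub>0: "finite J\<^sub>0" "card J\<^sub>0 = d" "P_shattered X UNIV A J\<^sub>0"
    unfolding A_def
    by (rule P_shattered_level_matrix_exists[OF \<open>{..<2 ^ d} \<subseteq> X\<close>, of "\<lambda>r. r div 2 ^ d"]) auto
  show "Pdim X UNIV A = enat d"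
  proof (rule Pdim_eqI[OF J\<^sub>0(1,3,2)])
    fix J assume J: "finite J" "P_shattered X UNIV A J"
    show "card J \<le> d"
    proof (rule ccontr)
      assume "\<not> card J \<le> d"
      then have "card J \<ge> 2" "Suc d \<le> card J" using assms(1) by auto
      obtain c where "2 ^ card J \<le> card {r \<in> X. r div 2 ^ d = c}
          + of_bool (\<exists>r\<in>X. r div 2 ^ d < c) + of_bool (\<exists>r\<in>X. r div 2 ^ d > c)"
        using J(2) unfolding A_def
        by (rule P_shattered_level_matrix_bound[OF fin J(1) \<open>card J \<ge> 2\<close>])
      \<comment> \<open>At most \<open>2 ^ d\<close> patterns come from level \<open>c\<close> and
        two from the other levels. More than \<open>d\<close> columns would need at least
        \<open>2 * 2 ^ d\<close> patterns, and \<open>2 ^ d \<ge> 4\<close> because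
        \<open>d \<ge> 2\<close>.\<close>
      also have "\<dots> \<le> 2 ^ d + 1 + 1"
        using card_level by (intro add_mono) auto
      finally have "2 ^ card J \<le> (2 ^ d + 2 :: nat)" by simp
      moreover have "(2::nat) ^ Suc d \<le> 2 ^ card J"
        using \<open>Suc d \<le> card J\<close> by (rule power_increasing) simp
      moreover have "(2::nat) ^ 2 \<le> 2 ^ d" using assms(1) by (rule power_increasing) simp
      ultimately show False by simp
    qed
  qed
qed

text \<open>Truncated subtraction puts rows 0 and 1 on level 0, and the minimum puts rows
  \<open>k\<close> and \<open>k + 1\<close> on level \<open>k - 1\<close>. Two shattered columns
  would need four patterns, but only three are available.\<close>

lemma doubled_extreme_levels_matrix:
  fixes k :: nat
  assumes "k \<ge> 1"
  defines "X \<equiv> {..k + 1}" and "A \<equiv> level_matrix (\<lambda>r. min (r - 1) (k - 1))"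
  shows "A \<in> X \<times> UNIV \<rightarrow> real ` {0..k}" "Vdim X UNIV A = 1" "Pdim X UNIV A = 1"
    "dual_Pdim X UNIV A = enat (k + 2)"
proof -
  let ?l = "\<lambda>r. min (r - 1) (k - 1)"
  have fin: "finite X" by (simp add: X_def)
  show "A \<in> X \<times> UNIV \<rightarrow> real ` {0..k}"
    unfolding A_def using assms(1) by (intro level_matrix_in) auto
  show "dual_Pdim X UNIV A = enat (k + 2)"
    unfolding A_def dual_Pdim_level_matrix[OF fin] by (simp add: X_def)
  \<comment> \<open>An inner level has one row and gains both constant patterns. An extreme level
    has a second row but lacks the constant pattern from its empty side. For \<open>k = 1\<close>
    all three rows share level 0 and there are no other levels.\<close>
  have three: "card {r \<in> X. ?l r = c} + of_bool (\<exists>r\<in>X. ?l r < c) + of_bool (\<exists>r\<in>X. ?l r > c) \<le> 3"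
    for c
  proof -
    have no_lo: "\<not> (\<exists>r\<in>X. ?l r < c)" if "c = 0" using that by simp
    have no_hi: "\<not> (\<exists>r\<in>X. ?l r > c)" if "c \<ge> k - 1" using that by auto
    have sub: "{r \<in> X. ?l r = c} \<subseteq>
        {c + 1} \<union> (if c = 0 then {0} else {}) \<union> (if c = k - 1 then {k + 1} else {})"
      using assms(1) by (auto simp: X_def min_def split: if_splits)
    have "card {r \<in> X. ?l r = c} \<le> card ({c + 1} \<union> (if c = 0 then {0} else {}) \<union>
        (if c = k - 1 then {k + 1} else {}))"
      by (rule card_mono[OF _ sub]) auto
    also have "\<dots> \<le> 1 + of_bool (c = 0) + of_bool (c = k - 1)"
      by (rule order.trans[OF card_Un_le add_mono[OF order.trans[OF card_Un_le]]]) auto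
    finally show ?thesis using no_lo no_hi by (cases "c = 0"; cases "c = k - 1") auto
  qed
  have P_le: "card J \<le> 1" if J: "finite J" "P_shattered X UNIV A J" for J
  proof (rule ccontr)
    assume "\<not> card J \<le> 1"
    then have "card J \<ge> 2" by simp
    obtain c where "2 ^ card J \<le> card {r \<in> X. ?l r = c}
        + of_bool (\<exists>r\<in>X. ?l r < c) + of_bool (\<exists>r\<in>X. ?l r > c)"
      using J(2) unfolding A_def
      by (rule P_shattered_level_matrix_bound[OF fin J(1) \<open>card J \<ge> 2\<close>])
    also note three
    finally have "2 ^ card J \<le> (3 :: nat)" .
    moreover have "(2::nat) ^ 2 \<le> 2 ^ card J"
      using \<open>card J \<ge> 2\<close> by (rule power_increasing) simp
    ultimately show False by simp
  qed
  have V: "V_shattered X UNIV A {set_encode {0}}"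
    unfolding V_shattered_def
  proof (intro conjI exI[of _ 1] allI)
    fix b :: "nat \<Rightarrow> bool"
    show "\<exists>r\<in>X. \<forall>y\<in>{set_encode {0}}. 1 \<le> A (r, y) \<longleftrightarrow> b y"
      \<comment> \<open>Rows 0 and 1 both have level 0, and the chosen column marks only row 0, so
        their entries there are 1 and 0.\<close>
      by (rule bexI[of _ "if b (set_encode {0}) then 0 else 1"])
        (simp_all add: A_def level_matrix_def X_def del: set_encode_insert)
  qed simp
  \<comment> \<open>One V-shattered column and one bound on P-shattered sets settle both dimensions,
    since V-shattering implies P-shattering.\<close>
  show "Vdim X UNIV A = 1"
    unfolding one_enat_def
    using V P_le[OF _ V_shattered_imp_P_shattered] by (intro Vdim_eqI[of "{set_encode {0}}"]) auto
  show "Pdim X UNIV A = 1"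
    unfolding one_enat_def
    using V P_le V_shattered_imp_P_shattered by (intro Pdim_eqI[of "{set_encode {0}}"]) auto
qed

theorem theorem7:
  shows "(\<forall>d k :: nat. d \<ge> 2 \<longrightarrow> k \<ge> 1 \<longrightarrow>
           (\<exists>(X :: nat set) (Y :: nat set) (A :: nat \<times> nat \<Rightarrow> real).
              A \<in> X \<times> Y \<rightarrow> real ` {0..k} \<and>
              Pdim X Y A = enat d \<and>
              dual_Vdim X Y A = enat (2 ^ d) \<and>
              dual_Pdim X Y A = enat (k * 2 ^ d)))
       \<and> (\<forall>k :: nat. k \<ge> 1 \<longrightarrow>
           (\<exists>(X :: nat set) (Y :: nat set) (A :: nat \<times> nat \<Rightarrow> real).
              A \<in> X \<times> Y \<rightarrow> real ` {0..k} \<and>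
              Vdim X Y A = 1 \<and>
              Pdim X Y A = 1 \<and>
              dual_Pdim X Y A = enat (k + 2)))"
proof (intro conjI allI impI)
  fix d k :: nat
  assume "d \<ge> 2" "k \<ge> 1"
  from equal_levels_matrix[OF this]
  show "\<exists>(X :: nat set) (Y :: nat set) (A :: nat \<times> nat \<Rightarrow> real).
      A \<in> X \<times> Y \<rightarrow> real ` {0..k} \<and> Pdim X Y A = enat d \<and>
      dual_Vdim X Y A = enat (2 ^ d) \<and> dual_Pdim X Y A = enat (k * 2 ^ d)"
    by (intro exI conjI)
next
  fix k :: nat
  assume "k \<ge> 1"
  from doubled_extreme_levels_matrix[OF this]
  show "\<exists>(X :: nat set) (Y :: nat set) (A :: nat \<times> nat \<Rightarrow> real).
      A \<in> X \<times> Y \<rightarrow> real ` {0..k} \<and> Vdim X Y A = 1 \<and> Pdim X Y A = 1 \<and>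
      dual_Pdim X Y A = enat (k + 2)"
    by (intro exI conjI)
qed

end
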